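(* Let $\{\mathbf{w}_n^i\}_{n\ge 0,\ i\in[N]}$ be a solution of the predictor-corrector CBO algorithm on $\mathcal S$ described in the context, and suppose that the parameters satisfy $$\sigma>0,\qquad 2\lambda>\sigma^2,\qquad 0<h<\frac{2\lambda-\sigma^2}{\lambda^2}.$$ Then there exists a random vector $\mathbf w_\infty$ (the same for all particles) such that $$\lim_{n\to\infty}\mathbf w_n^i=\mathbf w_\infty\quad\text{almost surely},\qquad i\in[N].$$
   Context: Let $d,N\ge 1$ be integers, $[N]=\{1,\dots,N\}$, $\|\cdot\|$ the Euclidean norm on $\mathbb R^d$, and $\mathcal S\subset\mathbb R^d$ a nonempty closed convex set. Let $L:\mathcal S\to\mathbb R$ be a continuous objective function. Let $\mathbb P_{\mathcal S}[\hat{\mathbf w}]:=\arg\min_{\mathbf w\in\mathcal S}\|\mathbf w-\hat{\mathbf w}\|^2$ be the projection onto $\mathcal S$, and let $\odot$ denote the componentwise (Hadamard) product. The parameters are the drift rate $\lambda$, the noise intensity $\sigma$, the time step $h>0$ and $\beta>0$. Noise: $\eta_n=(\eta_n^1,\dots,\eta_n^d)^\top$, $n\ge0$, where the real random variables $\eta_n^l$ ($n\ge 0$, $1\le l\le d$) are i.i.d. with $\mathbb E[\eta_n^l]=0$ and $\mathbb E[\eta_n^{l_1}\eta_k^{l_2}]=\delta_{l_1l_2}\delta_{nk}$. The same $\eta_n$ is used for all particles. The noise family is independent of the initial data $(\mathbf w_0^i)_{i\in[N]}$, so that for each $n$ the vector $\eta_n$ is independent of $(\mathbf w_k^i)_{k\le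 n,\,i\in[N]}$. Predictor-corrector CBO algorithm: starting from $\mathcal S$-valued random vectors $\mathbf w_0^i$, $i\in[N]$, for $n\ge0$ and $i\in[N]$, $$\hat{\mathbf w}^i_{n+1}=\mathbf w_n^i-\lambda h(\mathbf w_n^i-\bar{\mathbf w}_n)+\sigma\sqrt h\,(\mathbf w_n^i-\bar{\mathbf w}_n)\odot\eta_n,\qquad \mathbf w_{n+1}^i=\mathbb P_{\mathcal S}[\hat{\mathbf w}_{n+1}^i],$$ $$\bar{\mathbf w}_n:=\frac{\sum_{l=1}^N\mathbf w_n^l e^{-\beta L(\mathbf w_n^l)}}{\sum_{l=1}^N e^{-\beta L(\mathbf w_n^l)}}.$$ *)

theory Defs
  imports "HOL-Probability.Probability"
begin

text \<open>The projection onto a closed convex set is the library's closest-point map; it is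
  the unique minimiser of the squared Euclidean distance.\<close>

lemma closest_point_eq_arg_min_on:
  fixes S :: "(real ^ 'd) set"
  assumes "closed S" "convex S" "S \<noteq> {}"
  shows "closest_point S x = arg_min_on (\<lambda>y. (norm (y - x))\<^sup>2) S"
proof -
  have min: "is_arg_min (\<lambda>y. (norm (y - x))\<^sup>2) (\<lambda>y. y \<in> S) (closest_point S x)"
    using closest_point_in_set[OF assms(1,3)] closest_point_le[OF assms(1)]
    by (simp add: is_arg_min_linorder dist_norm norm_minus_commute power_mono)
  have "y = closest_point S x" if "is_arg_min (\<lambda>y. (norm (y - x))\<^sup>2) (\<lambda>y. y \<in> S) y" for y
    using that assms(1,2)
    by (intro closest_point_unique)
      (auto simp: is_arg_min_linorder dist_norm norm_minus_commute)
  with min show ?thesis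
    unfolding arg_min_on_def arg_min_def by (metis (no_types, lifting) someI_ex)
qed

definition cbo_mean :: "(real ^ 'd \<Rightarrow> real) \<Rightarrow> real \<Rightarrow> nat \<Rightarrow> (nat \<Rightarrow> real ^ 'd) \<Rightarrow> real ^ 'd" where
  "cbo_mean L \<beta> N W =
     (\<Sum>l=1..N. exp (- \<beta> * L (W l)) *\<^sub>R W l) /\<^sub>R (\<Sum>l=1..N. exp (- \<beta> * L (W l)))"

text \<open>On vectors, multiplication is componentwise, so the last product below is the
  Hadamard product.\<close>

definition cbo_predictor ::
    "real \<Rightarrow> real \<Rightarrow> real \<Rightarrow> real ^ 'd \<Rightarrow> real ^ 'd \<Rightarrow> real ^ 'd \<Rightarrow> real ^ 'd" where
  "cbo_predictor lam \<sigma> h m x z = x - (lam * h) *\<^sub>R (x - m) + (\<sigma> * sqrt h) *\<^sub>R ((x - m) * z)"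

text \<open>Bochner integrals of non-integrable functions are 0, so integrability is required
  explicitly; integrability of the squares gives that of the entries and of their products.\<close>

definition cbo_noise :: "'a measure \<Rightarrow> (nat \<Rightarrow> 'a \<Rightarrow> real ^ 'd) \<Rightarrow> bool" where
  "cbo_noise M \<eta> \<longleftrightarrow>
     prob_space.indep_vars M (\<lambda>_. borel) (\<lambda>(n, l) \<omega>. \<eta> n \<omega> $ l) UNIV \<and>
     (\<forall>n l k m. distr M borel (\<lambda>\<omega>. \<eta> n \<omega> $ l) = distr M borel (\<lambda>\<omega>. \<eta> k \<omega> $ m)) \<and>
     (\<forall>n l. integrable M (\<lambda>\<omega>. (\<eta> n \<omega> $ l)\<^sup>2)) \<and>
     (\<forall>n l. (\<integral>\<omega>. \<eta> n \<omega> $ l \<partial>M) = 0) \<and>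
     (\<forall>n l k m. (\<integral>\<omega>. \<eta> n \<omega> $ l * \<eta> k \<omega> $ m \<partial>M) = (if l = m \<and> n = k then 1 else 0))"

text \<open>Here \<open>w n i \<omega>\<close> is particle \<open>i\<close>, for \<open>i \<in> {1..N}\<close>, at step \<open>n\<close>.\<close>

definition cbo_initial_data ::
    "'a measure \<Rightarrow> (real ^ 'd) set \<Rightarrow> nat \<Rightarrow> (nat \<Rightarrow> 'a \<Rightarrow> real ^ 'd) \<Rightarrow> bool" where
  "cbo_initial_data M S N w0 \<longleftrightarrow>
     (\<forall>i\<in>{1..N}. w0 i \<in> borel_measurable M \<and> (\<forall>\<omega>\<in>space M. w0 i \<omega> \<in> S))"

definition cbo_noise_indep_initial ::
    "'a measure \<Rightarrow> nat \<Rightarrow> (nat \<Rightarrow> 'a \<Rightarrow> real ^ 'd) \<Rightarrow> (nat \<Rightarrow> 'a \<Rightarrow> real ^ 'd) \<Rightarrow> bool" where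
  "cbo_noise_indep_initial M N \<eta> w0 \<longleftrightarrow>
     prob_space.indep_var M
       (Pi\<^sub>M UNIV (\<lambda>_. borel)) (\<lambda>\<omega> n. \<eta> n \<omega>)
       (Pi\<^sub>M {1..N} (\<lambda>_. borel)) (\<lambda>\<omega>. \<lambda>i\<in>{1..N}. w0 i \<omega>)"

definition pc_cbo_solution ::
    "'a measure \<Rightarrow> (real ^ 'd) set \<Rightarrow> (real ^ 'd \<Rightarrow> real) \<Rightarrow> nat \<Rightarrow> real \<Rightarrow> real \<Rightarrow> real \<Rightarrow> real \<Rightarrow>
     (nat \<Rightarrow> 'a \<Rightarrow> real ^ 'd) \<Rightarrow> (nat \<Rightarrow> nat \<Rightarrow> 'a \<Rightarrow> real ^ 'd) \<Rightarrow> bool" where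
  "pc_cbo_solution M S L N lam \<sigma> h \<beta> \<eta> w \<longleftrightarrow>
     cbo_initial_data M S N (w 0) \<and>
     cbo_noise_indep_initial M N \<eta> (w 0) \<and>
     (\<forall>n. \<forall>i\<in>{1..N}. \<forall>\<omega>\<in>space M.
        w (Suc n) i \<omega> =
          closest_point S
            (cbo_predictor lam \<sigma> h (cbo_mean L \<beta> N (\<lambda>l. w n l \<omega>)) (w n i \<omega>) (\<eta> n \<omega>)))"

end

theory Submission
  imports Defs
begin

text \<open>The difference of two particles is multiplied, coordinate by coordinate, by the random
  factor \<open>1 - \<lambda>h + \<sigma>\<surd>h \<eta>\<close> before projection, because the weighted mean and
  the noise are common to all particles.
  The factor has mean square \<open>q = (1 - \<lambda>h)\<^sup>2 + \<sigma>\<^sup>2h\<close> and is independent of the past, and the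
  projection onto a convex set does not expand distances. So the mean square distance of two
  particles decays like \<open>q\<^sup>n\<close> (\<open>pairwise_second_moment\<close>), and the condition on the step size says
  exactly that \<open>q < 1\<close>. The unprojected step of one particle is its displacement
  from the weighted mean, multiplied coordinate by coordinate by \<open>-\<lambda>h + \<sigma>\<surd>h \<eta>\<close>. The mean is
  a convex combination of the particles, so the mean square of the increment is \<open>O(q\<^sup>n)\<close> as well
  (\<open>increment_second_moment\<close>). A geometric bound on second moments makes the distances and the
  increments almost surely summable (\<open>AE_summable_if_geometric_second_moment\<close>). Summable increments
  make every particle converge, and vanishing distances make the limits equal
  (\<open>AE_consensus\<close>).

  The initial data may have infinite second moment, so these estimates are carried out
  for deterministic initial data only. The general case follows by Fubini: by independence the joint
  law of noise and initial data is a product measure, and convergence holds for almost every noise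
  given any fixed initial data (\<open>AE_consensus_random_initial_data\<close>).\<close>

section \<open>Probabilistic tools\<close>

lemma (in prob_space) nn_integral_mult_indep_var:
  fixes X Y :: "'a \<Rightarrow> ennreal"
  assumes "indep_var borel X borel Y"
  shows "(\<integral>\<^sup>+\<omega>. X \<omega> * Y \<omega> \<partial>M) = (\<integral>\<^sup>+\<omega>. X \<omega> \<partial>M) * (\<integral>\<^sup>+\<omega>. Y \<omega> \<partial>M)"
proof -
  have "case_bool borel borel = (\<lambda>_. borel :: ennreal measure)"
    by (auto simp: fun_eq_iff split: bool.split)
  then have "indep_vars (\<lambda>_. borel) (case_bool X Y) UNIV"
    using assms by (simp add: indep_var_def)
  from indep_vars_nn_integral[OF _ this] show ?thesis
    by (simp add: UNIV_bool mult.commute)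
qed

text \<open>With \<open>r = \<surd>q\<close>, the elementary bound \<open>X\<^sub>n \<le> r\<^sup>n + X\<^sub>n\<^sup>2 / r\<^sup>n\<close> reduces the claim to the series of
  the \<open>X\<^sub>n\<^sup>2 / r\<^sup>n\<close>, whose expectation is at most \<open>\<Sum> C r\<^sup>n < \<infinity>\<close>.\<close>
lemma (in prob_space) AE_summable_if_geometric_second_moment:
  fixes X :: "nat \<Rightarrow> 'a \<Rightarrow> real"
  assumes [measurable]: "\<And>n. X n \<in> borel_measurable M"
    and nonneg: "\<And>n \<omega>. 0 \<le> X n \<omega>"
    and "0 < q" "q < 1" "0 \<le> C"
    and bound: "\<And>n. (\<integral>\<^sup>+\<omega>. ennreal ((X n \<omega>)\<^sup>2) \<partial>M) \<le> ennreal (C * q ^ n)"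
  shows "AE \<omega> in M. summable (\<lambda>n. X n \<omega>)"
proof -
  define r where "r = sqrt q"
  have r: "0 < r" "r < 1" "r\<^sup>2 = q"
    using assms(3,4) by (auto simp: r_def)
  have moment: "(\<integral>\<^sup>+\<omega>. ennreal ((X n \<omega>)\<^sup>2 / r ^ n) \<partial>M) \<le> ennreal (C * r ^ n)" for n
  proof -
    have "(\<integral>\<^sup>+\<omega>. ennreal ((X n \<omega>)\<^sup>2 / r ^ n) \<partial>M)
        = (\<integral>\<^sup>+\<omega>. ennreal (1 / r ^ n) * ennreal ((X n \<omega>)\<^sup>2) \<partial>M)"
      using r by (simp flip: ennreal_mult)
    also have "\<dots> = ennreal (1 / r ^ n) * (\<integral>\<^sup>+\<omega>. ennreal ((X n \<omega>)\<^sup>2) \<partial>M)"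
      by (rule nn_integral_cmult) measurable
    also have "\<dots> \<le> ennreal (1 / r ^ n) * ennreal (C * q ^ n)"
      using bound by (intro mult_left_mono) auto
    also have "\<dots> = ennreal (1 / r ^ n * (C * q ^ n))"
      using r assms(3,5) by (intro ennreal_mult[symmetric]) auto
    also have "1 / r ^ n * (C * q ^ n) = C * r ^ n"
      using r(1) by (simp add: r(3)[symmetric] power2_eq_square power_mult_distrib)
    finally show ?thesis .
  qed
  have "(\<integral>\<^sup>+\<omega>. (\<Sum>n. ennreal ((X n \<omega>)\<^sup>2 / r ^ n)) \<partial>M)
      = (\<Sum>n. \<integral>\<^sup>+\<omega>. ennreal ((X n \<omega>)\<^sup>2 / r ^ n) \<partial>M)"
    by (rule nn_integral_suminf) measurable
  also have "\<dots> \<le> (\<Sum>n. ennreal (C * r ^ n))"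
    using moment by (intro suminf_le) auto
  also have "\<dots> = ennreal (\<Sum>n. C * r ^ n)"
    using r assms(5) by (intro suminf_ennreal2) (auto intro!: summable_mult summable_geometric)
  also have "\<dots> < \<infinity>" by simp
  finally have "AE \<omega> in M. (\<Sum>n. ennreal ((X n \<omega>)\<^sup>2 / r ^ n)) \<noteq> \<infinity>"
    by (intro nn_integral_PInf_AE) auto
  then show ?thesis
  proof eventually_elim
    case (elim \<omega>)
    then have "summable (\<lambda>n. (X n \<omega>)\<^sup>2 / r ^ n)"
      using r by (intro summable_suminf_not_top) auto
    then have "summable (\<lambda>n. r ^ n + (X n \<omega>)\<^sup>2 / r ^ n)"
      using r by (intro summable_add summable_geometric) auto
    moreover have "norm (X n \<omega>) \<le> r ^ n + (X n \<omega>)\<^sup>2 / r ^ n" for n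
    proof (cases "X n \<omega> \<le> r ^ n")
      case True
      then show ?thesis using nonneg[of n \<omega>] r by (simp add: add_increasing2)
    next
      case False
      then have "X n \<omega> * r ^ n \<le> (X n \<omega>)\<^sup>2"
        using nonneg[of n \<omega>] by (simp add: power2_eq_square mult_left_mono)
      then have "X n \<omega> \<le> (X n \<omega>)\<^sup>2 / r ^ n"
        using r by (simp add: field_simps)
      then show ?thesis using nonneg[of n \<omega>] r by (simp add: add_increasing)
    qed
    ultimately show ?case
      by (rule summable_comparison_test'[where N=0])
  qed
qed

section \<open>Second moments under one multiplicative noise step\<close>

lemma borel_measurable_vec_nth [measurable]:
  "(\<lambda>x::real^'d. x $ l) \<in> borel_measurable borel"
  by (intro borel_measurable_continuous_onI continuous_intros)

lemma borel_measurable_vec_lambda: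
  fixes f :: "'d::finite \<Rightarrow> 'a \<Rightarrow> real"
  assumes [measurable]: "\<And>l. f l \<in> borel_measurable M"
  shows "(\<lambda>x. \<chi> l. f l x) \<in> borel_measurable M"
proof -
  have "(\<lambda>x. \<chi> l. f l x) = (\<lambda>x. \<Sum>l\<in>UNIV. f l x *\<^sub>R axis l 1)"
    by (auto simp: fun_eq_iff vec_eq_iff axis_def if_distrib cong: if_cong)
  then show ?thesis by simp
qed

lemma borel_measurable_hadamard:
  fixes f g :: "'a \<Rightarrow> real^'d"
  assumes [measurable]: "f \<in> borel_measurable M" "g \<in> borel_measurable M"
  shows "(\<lambda>x. f x * g x) \<in> borel_measurable M"
proof -
  have "(\<lambda>x. \<chi> l. f x $ l * g x $ l) \<in> borel_measurable M"
    by (rule borel_measurable_vec_lambda) measurable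
  then show ?thesis by (simp add: times_vec_def)
qed

lemma power2_norm_vec: "(norm (v::real^'d))\<^sup>2 = (\<Sum>l\<in>UNIV. (v $ l)\<^sup>2)"
  by (simp add: norm_vec_def L2_set_def sum_nonneg)

lemma cbo_noise_measurable:
  assumes "prob_space M" "cbo_noise M \<eta>"
  shows "\<eta> n \<in> borel_measurable M"
proof -
  interpret prob_space M by fact
  have "indep_vars (\<lambda>_. borel) (\<lambda>(n, l) \<omega>. \<eta> n \<omega> $ l) UNIV"
    using assms by (simp add: cbo_noise_def)
  then have "(\<lambda>(n, l) \<omega>. \<eta> n \<omega> $ l) (n, l) \<in> borel_measurable M" for l
    unfolding indep_vars_def by blast
  then have "(\<lambda>\<omega>. \<chi> l. \<eta> n \<omega> $ l) \<in> borel_measurable M"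
    by (intro borel_measurable_vec_lambda) simp
  then show ?thesis by (simp add: vec_nth_inverse)
qed

lemma (in prob_space) cbo_noise_affine_second_moment:
  assumes "cbo_noise M \<eta>"
  shows "(\<integral>\<^sup>+\<omega>. ennreal ((c + b * \<eta> n \<omega> $ l)\<^sup>2) \<partial>M) = ennreal (c\<^sup>2 + b\<^sup>2)"
proof -
  have [measurable]: "\<eta> n \<in> borel_measurable M"
    by (rule cbo_noise_measurable) (use assms prob_space_axioms in auto)
  have sq: "integrable M (\<lambda>\<omega>. (\<eta> n \<omega> $ l)\<^sup>2)" and mean: "(\<integral>\<omega>. \<eta> n \<omega> $ l \<partial>M) = 0"
    using assms by (auto simp: cbo_noise_def)
  have var: "(\<integral>\<omega>. (\<eta> n \<omega> $ l)\<^sup>2 \<partial>M) = 1"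
    using assms by (simp add: cbo_noise_def power2_eq_square)
  have int: "integrable M (\<lambda>\<omega>. \<eta> n \<omega> $ l)"
    by (rule square_integrable_imp_integrable[OF _ sq]) measurable
  have expand: "(c + b * x)\<^sup>2 = c\<^sup>2 + 2 * c * b * x + b\<^sup>2 * x\<^sup>2" for x
    by (simp add: power2_eq_square algebra_simps)
  have "(\<integral>\<^sup>+\<omega>. ennreal ((c + b * \<eta> n \<omega> $ l)\<^sup>2) \<partial>M)
      = ennreal (\<integral>\<omega>. (c + b * \<eta> n \<omega> $ l)\<^sup>2 \<partial>M)"
  proof (rule nn_integral_eq_integral)
    show "integrable M (\<lambda>\<omega>. (c + b * \<eta> n \<omega> $ l)\<^sup>2)"
      unfolding expand using int sq by simp
  qed simp
  also have "(\<integral>\<omega>. (c + b * \<eta> n \<omega> $ l)\<^sup>2 \<partial>M) = c\<^sup>2 + b\<^sup>2"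
    unfolding expand using int sq by (simp add: mean var prob_space)
  finally show ?thesis .
qed

text \<open>In coordinate \<open>l\<close> the vector is \<open>D\<^sub>l (c + b \<eta>\<^sub>n\<^sub>l)\<close>, a product of independent factors.
  The nonnegative integral of the squared product factors directly, without expanding the
  square, so no cross term has to be integrated. That \<open>D\<close> depends on the past only is expressed by
  factoring it through the noise entries before time \<open>n\<close>.\<close>
lemma (in prob_space) nn_integral_noise_step:
  fixes \<eta> :: "nat \<Rightarrow> 'a \<Rightarrow> real^'d" and g :: "(nat \<times> 'd \<Rightarrow> real) \<Rightarrow> real^'d"
  assumes noise: "cbo_noise M \<eta>"
    and [measurable]: "g \<in> Pi\<^sub>M ({..<n} \<times> UNIV) (\<lambda>_. borel) \<rightarrow>\<^sub>M borel"
    and D: "\<And>\<omega>. D \<omega> = g (\<lambda>p\<in>{..<n} \<times> UNIV. \<eta> (fst p) \<omega> $ snd p)"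
  shows "(\<integral>\<^sup>+\<omega>. ennreal ((norm (c *\<^sub>R D \<omega> + b *\<^sub>R (D \<omega> * \<eta> n \<omega>)))\<^sup>2) \<partial>M)
    = ennreal (c\<^sup>2 + b\<^sup>2) * (\<integral>\<^sup>+\<omega>. ennreal ((norm (D \<omega>))\<^sup>2) \<partial>M)"
proof -
  have [measurable]: "\<eta> k \<in> borel_measurable M" for k
    by (rule cbo_noise_measurable) (use noise prob_space_axioms in auto)
  have entries: "indep_vars (\<lambda>_. borel) (\<lambda>p \<omega>. \<eta> (fst p) \<omega> $ snd p) UNIV"
    using noise by (simp add: cbo_noise_def case_prod_beta')
  have [measurable]: "D \<in> borel_measurable M"
    unfolding D[abs_def] by measurable
  have coord: "(\<integral>\<^sup>+\<omega>. ennreal ((D \<omega> $ l)\<^sup>2) * ennreal ((c + b * \<eta> n \<omega> $ l)\<^sup>2) \<partial>M)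
      = (\<integral>\<^sup>+\<omega>. ennreal ((D \<omega> $ l)\<^sup>2) \<partial>M) * ennreal (c\<^sup>2 + b\<^sup>2)" for l
  proof -
    have "indep_var borel ((\<lambda>e. ennreal ((g e $ l)\<^sup>2)) \<circ>
          (\<lambda>\<omega>. \<lambda>p\<in>{..<n} \<times> UNIV. \<eta> (fst p) \<omega> $ snd p))
        borel ((\<lambda>e. ennreal ((c + b * e (n, l))\<^sup>2)) \<circ>
          (\<lambda>\<omega>. \<lambda>p\<in>{(n, l)}. \<eta> (fst p) \<omega> $ snd p))"
    proof (rule indep_var_compose[OF indep_var_restrict[OF entries]])
      show "(\<lambda>e. ennreal ((g e $ l)\<^sup>2)) \<in> Pi\<^sub>M ({..<n} \<times> UNIV) (\<lambda>_. borel) \<rightarrow>\<^sub>M borel"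
        by measurable
      show "(\<lambda>e. ennreal ((c + b * e (n, l))\<^sup>2)) \<in> Pi\<^sub>M {(n, l)} (\<lambda>_. borel) \<rightarrow>\<^sub>M borel"
        by measurable
    qed auto
    from nn_integral_mult_indep_var[OF this] show ?thesis
      by (simp add: o_def flip: D cbo_noise_affine_second_moment[OF noise, of c b n l])
  qed
  have "(\<integral>\<^sup>+\<omega>. ennreal ((norm (c *\<^sub>R D \<omega> + b *\<^sub>R (D \<omega> * \<eta> n \<omega>)))\<^sup>2) \<partial>M)
      = (\<integral>\<^sup>+\<omega>. (\<Sum>l\<in>UNIV. ennreal ((D \<omega> $ l)\<^sup>2) * ennreal ((c + b * \<eta> n \<omega> $ l)\<^sup>2)) \<partial>M)"
  proof (intro nn_integral_cong)
    fix \<omega>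
    have "(norm (c *\<^sub>R D \<omega> + b *\<^sub>R (D \<omega> * \<eta> n \<omega>)))\<^sup>2
        = (\<Sum>l\<in>UNIV. (D \<omega> $ l)\<^sup>2 * (c + b * \<eta> n \<omega> $ l)\<^sup>2)"
      unfolding power2_norm_vec
      by (intro sum.cong) (simp_all add: power2_eq_square algebra_simps)
    then show "ennreal ((norm (c *\<^sub>R D \<omega> + b *\<^sub>R (D \<omega> * \<eta> n \<omega>)))\<^sup>2)
        = (\<Sum>l\<in>UNIV. ennreal ((D \<omega> $ l)\<^sup>2) * ennreal ((c + b * \<eta> n \<omega> $ l)\<^sup>2))"
      by (simp add: sum_ennreal[symmetric] ennreal_mult)
  qed
  also have "\<dots> = (\<Sum>l\<in>UNIV. (\<integral>\<^sup>+\<omega>. ennreal ((D \<omega> $ l)\<^sup>2) \<partial>M)) * ennreal (c\<^sup>2 + b\<^sup>2)"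
    by (simp add: nn_integral_sum coord sum_distrib_right)
  also have "(\<Sum>l\<in>UNIV. (\<integral>\<^sup>+\<omega>. ennreal ((D \<omega> $ l)\<^sup>2) \<partial>M)) = (\<integral>\<^sup>+\<omega>. ennreal ((norm (D \<omega>))\<^sup>2) \<partial>M)"
    by (simp add: nn_integral_sum[symmetric] power2_norm_vec sum_ennreal)
  finally show ?thesis by (simp add: mult.commute)
qed

section \<open>The algorithm as a function of initial data and noise\<close>

text \<open>A ball around \<open>x\<close> that contains all particles contains their weighted mean by convexity.
  The squared radius is taken to be a sum, not a maximum, because a sum can be integrated
  term by term.\<close>
lemma norm_diff_cbo_mean_le:
  assumes "N \<ge> 1"
  shows "(norm (x - cbo_mean L \<beta> N W))\<^sup>2 \<le> (\<Sum>j=1..N. (norm (x - W j))\<^sup>2)"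
proof -
  define T where "T = (\<Sum>l=1..N. exp (- \<beta> * L (W l)))"
  define R where "R = sqrt (\<Sum>j=1..N. (norm (x - W j))\<^sup>2)"
  have "T > 0" unfolding T_def using assms by (intro sum_pos) auto
  have "(\<Sum>l=1..N. (exp (- \<beta> * L (W l)) / T) *\<^sub>R W l) \<in> cball x R"
  proof (rule convex_sum)
    show "(\<Sum>l=1..N. exp (- \<beta> * L (W l)) / T) = 1"
      using \<open>T > 0\<close> by (simp add: T_def flip: sum_divide_distrib)
    fix j assume "j \<in> {1..N}"
    then have "(norm (x - W j))\<^sup>2 \<le> (\<Sum>j=1..N. (norm (x - W j))\<^sup>2)"
      by (intro member_le_sum) auto
    then show "W j \<in> cball x R"
      by (simp add: R_def dist_norm real_le_rsqrt)
  qed (use \<open>T > 0\<close> in auto)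
  also have "(\<Sum>l=1..N. (exp (- \<beta> * L (W l)) / T) *\<^sub>R W l) = cbo_mean L \<beta> N W"
    by (simp add: cbo_mean_def T_def scaleR_sum_right divide_inverse_commute)
  finally have "norm (x - cbo_mean L \<beta> N W) \<le> R" by (simp add: dist_norm)
  then have "(norm (x - cbo_mean L \<beta> N W))\<^sup>2 \<le> R\<^sup>2" by (intro power_mono) auto
  then show ?thesis by (simp add: R_def sum_nonneg)
qed

locale projected_cbo =
  fixes S :: "(real ^ 'd) set" and L :: "real ^ 'd \<Rightarrow> real" and N :: nat
    and lam \<sigma> h \<beta> :: real
  assumes N: "N \<ge> 1"
    and S: "S \<noteq> {}" "closed S" "convex S"
    and L: "continuous_on S L"
begin

abbreviation proj where "proj \<equiv> closest_point S"

text \<open>The recursion of the algorithm for fixed initial data \<open>x\<close> and noise sequence \<open>z\<close>. Composing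
  \<open>L\<close> with the projection and projecting the initial data changes nothing for data in \<open>S\<close>. It makes
  the path jointly Borel measurable on all of \<open>(x, z)\<close>, although \<open>L\<close> is continuous only on \<open>S\<close>, and
  keeps the path in \<open>S\<close> even when \<open>x\<close> does not lie in \<open>S\<close>.\<close>
primrec cbo_path :: "(nat \<Rightarrow> real^'d) \<Rightarrow> (nat \<Rightarrow> real^'d) \<Rightarrow> nat \<Rightarrow> nat \<Rightarrow> real^'d" where
  "cbo_path x z 0 = (\<lambda>i. proj (x i))"
| "cbo_path x z (Suc n) = (\<lambda>i. proj (cbo_predictor lam \<sigma> h
     (cbo_mean (L \<circ> proj) \<beta> N (cbo_path x z n)) (cbo_path x z n i) (z n)))"

lemma path_in: "cbo_path x z n i \<in> S"
  by (cases n) (simp_all add: closest_point_in_set S)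

lemma norm_proj_diff_le: "norm (proj u - proj v) \<le> norm (u - v)"
  using closest_point_lipschitz[OF S(3,2,1), of u v] by (simp add: dist_norm)

lemma path_cong_noise:
  assumes "\<And>k. k < n \<Longrightarrow> z k = z' k"
  shows "cbo_path x z n = cbo_path x z' n"
  using assms by (induction n) auto

lemma solution_eq_path:
  assumes "pc_cbo_solution M S L N lam \<sigma> h \<beta> \<eta> w" "\<omega> \<in> space M" "i \<in> {1..N}"
  shows "w n i \<omega> = cbo_path (\<lambda>l\<in>{1..N}. w 0 l \<omega>) (\<lambda>k. \<eta> k \<omega>) n i"
  using assms(3)
proof (induction n arbitrary: i)
  case 0
  then have "w 0 i \<omega> \<in> S"
    using assms(1,2) by (auto simp: pc_cbo_solution_def cbo_initial_data_def)
  then show ?case using 0 by (simp add: closest_point_self)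
next
  case (Suc n)
  define y where "y = cbo_path (\<lambda>l\<in>{1..N}. w 0 l \<omega>) (\<lambda>k. \<eta> k \<omega>) n"
  have y: "w n l \<omega> = y l" if "l \<in> {1..N}" for l
    using Suc.IH[OF that] by (simp only: y_def)
  have "proj (y l) = y l" for l
    by (simp add: y_def closest_point_self path_in)
  then have "cbo_mean L \<beta> N (\<lambda>l. w n l \<omega>) = cbo_mean (L \<circ> proj) \<beta> N y"
    unfolding cbo_mean_def by (simp add: y)
  moreover have "w (Suc n) i \<omega>
      = proj (cbo_predictor lam \<sigma> h (cbo_mean L \<beta> N (\<lambda>l. w n l \<omega>)) (w n i \<omega>) (\<eta> n \<omega>))"
    using assms(1,2) Suc.prems unfolding pc_cbo_solution_def by blast
  ultimately show ?case
    using y[OF Suc.prems] by (simp only: cbo_path.simps y_def)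
qed

lemma proj_measurable [measurable]: "proj \<in> borel_measurable borel"
  by (intro borel_measurable_continuous_onI continuous_on_closest_point S)

lemma L_proj_measurable [measurable]: "(\<lambda>x. L (proj x)) \<in> borel_measurable borel"
  by (intro borel_measurable_continuous_onI continuous_on_compose2[OF L]
      continuous_on_closest_point S) (auto simp: closest_point_in_set S)

lemma cbo_mean_path_measurable:
  assumes [measurable]: "\<And>i. i \<in> {1..N} \<Longrightarrow> (\<lambda>\<omega>. W \<omega> i) \<in> borel_measurable Q"
  shows "(\<lambda>\<omega>. cbo_mean (L \<circ> proj) \<beta> N (W \<omega>)) \<in> borel_measurable Q"
  unfolding cbo_mean_def o_def by measurable

lemma path_measurable:
  assumes "\<And>k. k < n \<Longrightarrow> (\<lambda>\<omega>. z \<omega> k) \<in> borel_measurable Q"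
    and [measurable]: "\<And>i. i \<in> {1..N} \<Longrightarrow> (\<lambda>\<omega>. x \<omega> i) \<in> borel_measurable Q"
    and "i \<in> {1..N}"
  shows "(\<lambda>\<omega>. cbo_path (x \<omega>) (z \<omega>) n i) \<in> borel_measurable Q"
  using assms(1,3)
proof (induction n arbitrary: i)
  case 0
  then show ?case by simp
next
  case (Suc n)
  have [measurable]: "(\<lambda>\<omega>. cbo_path (x \<omega>) (z \<omega>) n j) \<in> borel_measurable Q" if "j \<in> {1..N}" for j
    using Suc that by simp
  have [measurable]: "(\<lambda>\<omega>. cbo_mean (L \<circ> proj) \<beta> N (cbo_path (x \<omega>) (z \<omega>) n)) \<in> borel_measurable Q"
    by (rule cbo_mean_path_measurable) measurable
  have [measurable]: "(\<lambda>\<omega>. z \<omega> n) \<in> borel_measurable Q" using Suc by simp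
  note [measurable] = borel_measurable_hadamard
  show ?case using \<open>i \<in> {1..N}\<close>
    unfolding cbo_path.simps cbo_predictor_def by measurable
qed

section \<open>Deterministic initial data\<close>

abbreviation contraction where "contraction \<equiv> (1 - lam * h)\<^sup>2 + (\<sigma> * sqrt h)\<^sup>2"

text \<open>The path at time \<open>n\<close> in the form that \<open>nn_integral_noise_step\<close> needs: a function of the scalar
  noise entries before time \<open>n\<close>.\<close>
lemma path_from_entries:
  "cbo_path x z n
    = cbo_path x (\<lambda>k. \<chi> l. (\<lambda>p\<in>{..<n} \<times> UNIV. z (fst p) $ snd p) (k, l)) n"
  by (rule path_cong_noise) (simp add: vec_eq_iff)

lemma path_entries_measurable:
  assumes "i \<in> {1..N}"
  shows "(\<lambda>e. cbo_path x (\<lambda>k. \<chi> l. e (k, l)) n i)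
    \<in> Pi\<^sub>M ({..<n} \<times> (UNIV :: 'd set)) (\<lambda>_. borel) \<rightarrow>\<^sub>M borel"
  by (rule path_measurable[OF _ _ assms])
    (auto intro!: borel_measurable_vec_lambda measurable_component_singleton)

context
  fixes M :: "'a measure" and \<eta> :: "nat \<Rightarrow> 'a \<Rightarrow> real^'d" and x :: "nat \<Rightarrow> real^'d"
  assumes M: "prob_space M" and noise: "cbo_noise M \<eta>"
begin

interpretation prob_space M by (rule M)

abbreviation X where "X n i \<omega> \<equiv> cbo_path x (\<lambda>k. \<eta> k \<omega>) n i"

lemma X_measurable: "i \<in> {1..N} \<Longrightarrow> X n i \<in> borel_measurable M"
  by (intro path_measurable cbo_noise_measurable[OF M noise]) auto

text \<open>The weighted mean is the same for both particles and cancels in the difference of the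
  predictors, which is therefore a noise step applied to the previous difference.\<close>
lemma pairwise_second_moment:
  assumes "i \<in> {1..N}" "j \<in> {1..N}"
  shows "(\<integral>\<^sup>+\<omega>. ennreal ((norm (X n i \<omega> - X n j \<omega>))\<^sup>2) \<partial>M)
    \<le> ennreal ((norm (proj (x i) - proj (x j)))\<^sup>2 * contraction ^ n)"
proof (induction n)
  case 0
  show ?case by (simp add: emeasure_space_1)
next
  case (Suc n)
  let ?c = "1 - lam * h" and ?b = "\<sigma> * sqrt h"
  let ?D = "\<lambda>\<omega>. X n i \<omega> - X n j \<omega>"
  have pointwise: "(norm (X (Suc n) i \<omega> - X (Suc n) j \<omega>))\<^sup>2
      \<le> (norm (?c *\<^sub>R ?D \<omega> + ?b *\<^sub>R (?D \<omega> * \<eta> n \<omega>)))\<^sup>2" for \<omega>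
  proof -
    let ?m = "cbo_mean (L \<circ> proj) \<beta> N (cbo_path x (\<lambda>k. \<eta> k \<omega>) n)"
    have "cbo_predictor lam \<sigma> h ?m (X n i \<omega>) (\<eta> n \<omega>) - cbo_predictor lam \<sigma> h ?m (X n j \<omega>) (\<eta> n \<omega>)
        = ?c *\<^sub>R ?D \<omega> + ?b *\<^sub>R (?D \<omega> * \<eta> n \<omega>)"
      by (simp add: cbo_predictor_def vec_eq_iff algebra_simps)
    then show ?thesis
      unfolding cbo_path.simps by (intro power_mono norm_ge_zero) (metis norm_proj_diff_le)
  qed
  have "(\<integral>\<^sup>+\<omega>. ennreal ((norm (X (Suc n) i \<omega> - X (Suc n) j \<omega>))\<^sup>2) \<partial>M)
      \<le> (\<integral>\<^sup>+\<omega>. ennreal ((norm (?c *\<^sub>R ?D \<omega> + ?b *\<^sub>R (?D \<omega> * \<eta> n \<omega>)))\<^sup>2) \<partial>M)"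
    using pointwise by (intro nn_integral_mono ennreal_leI)
  also have "\<dots> = ennreal contraction * (\<integral>\<^sup>+\<omega>. ennreal ((norm (?D \<omega>))\<^sup>2) \<partial>M)"
  proof (rule nn_integral_noise_step[OF noise])
    show "?D \<omega> = (\<lambda>e. cbo_path x (\<lambda>k. \<chi> l. e (k, l)) n i - cbo_path x (\<lambda>k. \<chi> l. e (k, l)) n j)
        (\<lambda>p\<in>{..<n} \<times> UNIV. \<eta> (fst p) \<omega> $ snd p)" for \<omega>
      by (simp only: path_from_entries[of x "\<lambda>k. \<eta> k \<omega>" n, symmetric])
  qed (intro borel_measurable_diff path_entries_measurable assms)
  also have "\<dots> \<le> ennreal contraction
      * ennreal ((norm (proj (x i) - proj (x j)))\<^sup>2 * contraction ^ n)"
    using Suc.IH by (rule mult_left_mono) simp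
  also have "\<dots> = ennreal ((norm (proj (x i) - proj (x j)))\<^sup>2 * contraction ^ Suc n)"
    by (subst ennreal_mult[symmetric]) (auto simp: algebra_simps)
  finally show ?case .
qed

text \<open>Since \<open>X n i\<close> lies in \<open>S\<close>, it is its own projection, so the increment is no longer than the
  unprojected step, a noise step applied to the distance from the mean.\<close>
lemma increment_second_moment:
  assumes i: "i \<in> {1..N}"
  shows "(\<integral>\<^sup>+\<omega>. ennreal ((norm (X (Suc n) i \<omega> - X n i \<omega>))\<^sup>2) \<partial>M)
    \<le> ennreal ((((- (lam * h))\<^sup>2 + (\<sigma> * sqrt h)\<^sup>2)
        * (\<Sum>j=1..N. (norm (proj (x i) - proj (x j)))\<^sup>2)) * contraction ^ n)"
proof -
  let ?c = "- (lam * h)" and ?b = "\<sigma> * sqrt h"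
  let ?m = "\<lambda>z. cbo_mean (L \<circ> proj) \<beta> N (cbo_path x z n)"
  let ?D = "\<lambda>\<omega>. X n i \<omega> - ?m (\<lambda>k. \<eta> k \<omega>)"
  have pointwise: "(norm (X (Suc n) i \<omega> - X n i \<omega>))\<^sup>2
      \<le> (norm (?c *\<^sub>R ?D \<omega> + ?b *\<^sub>R (?D \<omega> * \<eta> n \<omega>)))\<^sup>2" for \<omega>
  proof -
    have "cbo_predictor lam \<sigma> h (?m (\<lambda>k. \<eta> k \<omega>)) (X n i \<omega>) (\<eta> n \<omega>) - X n i \<omega>
        = ?c *\<^sub>R ?D \<omega> + ?b *\<^sub>R (?D \<omega> * \<eta> n \<omega>)"
      by (simp add: cbo_predictor_def)
    moreover have "X n i \<omega> = proj (X n i \<omega>)"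
      by (simp add: closest_point_self path_in)
    ultimately show ?thesis
      using norm_proj_diff_le[of "cbo_predictor lam \<sigma> h (?m (\<lambda>k. \<eta> k \<omega>)) (X n i \<omega>) (\<eta> n \<omega>)" "X n i \<omega>"]
      by (auto intro!: power_mono)
  qed
  have "(\<integral>\<^sup>+\<omega>. ennreal ((norm (?D \<omega>))\<^sup>2) \<partial>M)
      \<le> (\<integral>\<^sup>+\<omega>. (\<Sum>j=1..N. ennreal ((norm (X n i \<omega> - X n j \<omega>))\<^sup>2)) \<partial>M)"
  proof (rule nn_integral_mono)
    fix \<omega>
    have "(norm (?D \<omega>))\<^sup>2 \<le> (\<Sum>j=1..N. (norm (X n i \<omega> - X n j \<omega>))\<^sup>2)"
      by (rule norm_diff_cbo_mean_le[OF N])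
    then show "ennreal ((norm (?D \<omega>))\<^sup>2) \<le> (\<Sum>j=1..N. ennreal ((norm (X n i \<omega> - X n j \<omega>))\<^sup>2))"
      by (simp only: sum_ennreal zero_le_power2 ennreal_leI)
  qed
  also have "\<dots> = (\<Sum>j=1..N. \<integral>\<^sup>+\<omega>. ennreal ((norm (X n i \<omega> - X n j \<omega>))\<^sup>2) \<partial>M)"
    using X_measurable i by (intro nn_integral_sum) simp
  also have "\<dots> \<le> (\<Sum>j=1..N. ennreal ((norm (proj (x i) - proj (x j)))\<^sup>2 * contraction ^ n))"
    by (intro sum_mono pairwise_second_moment i) simp
  also have "\<dots> = ennreal ((\<Sum>j=1..N. (norm (proj (x i) - proj (x j)))\<^sup>2) * contraction ^ n)"
    by (simp add: sum_distrib_right)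
  finally have spread: "(\<integral>\<^sup>+\<omega>. ennreal ((norm (?D \<omega>))\<^sup>2) \<partial>M)
      \<le> ennreal ((\<Sum>j=1..N. (norm (proj (x i) - proj (x j)))\<^sup>2) * contraction ^ n)" .
  have "(\<integral>\<^sup>+\<omega>. ennreal ((norm (X (Suc n) i \<omega> - X n i \<omega>))\<^sup>2) \<partial>M)
      \<le> (\<integral>\<^sup>+\<omega>. ennreal ((norm (?c *\<^sub>R ?D \<omega> + ?b *\<^sub>R (?D \<omega> * \<eta> n \<omega>)))\<^sup>2) \<partial>M)"
    using pointwise by (intro nn_integral_mono ennreal_leI)
  also have "\<dots> = ennreal (?c\<^sup>2 + ?b\<^sup>2) * (\<integral>\<^sup>+\<omega>. ennreal ((norm (?D \<omega>))\<^sup>2) \<partial>M)"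
  proof (rule nn_integral_noise_step[OF noise])
    show "?D \<omega> = (\<lambda>e. cbo_path x (\<lambda>k. \<chi> l. e (k, l)) n i - ?m (\<lambda>k. \<chi> l. e (k, l)))
        (\<lambda>p\<in>{..<n} \<times> UNIV. \<eta> (fst p) \<omega> $ snd p)" for \<omega>
      by (simp only: path_from_entries[of x "\<lambda>k. \<eta> k \<omega>" n, symmetric])
  qed (intro borel_measurable_diff cbo_mean_path_measurable path_entries_measurable i)
  also have "\<dots> \<le> ennreal (?c\<^sup>2 + ?b\<^sup>2)
      * ennreal ((\<Sum>j=1..N. (norm (proj (x i) - proj (x j)))\<^sup>2) * contraction ^ n)"
    using spread by (rule mult_left_mono) simp
  also have "\<dots> = ennreal (((?c\<^sup>2 + ?b\<^sup>2)
      * (\<Sum>j=1..N. (norm (proj (x i) - proj (x j)))\<^sup>2)) * contraction ^ n)"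
    unfolding mult.assoc by (rule ennreal_mult[symmetric]) (auto intro!: mult_nonneg_nonneg sum_nonneg)
  finally show ?thesis .
qed

lemma AE_consensus:
  assumes "0 < contraction" "contraction < 1" and i: "i \<in> {1..N}"
  shows "AE \<omega> in M. Cauchy (\<lambda>n. X n i \<omega>) \<and> lim (\<lambda>n. X n i \<omega>) = lim (\<lambda>n. X n 1 \<omega>)"
proof -
  have one: "1 \<in> {1..N}" using N by simp
  have summable_steps: "AE \<omega> in M. summable (\<lambda>n. norm (X (Suc n) j \<omega> - X n j \<omega>))"
    if j: "j \<in> {1..N}" for j
  proof (rule AE_summable_if_geometric_second_moment[OF _ _ assms(1,2) _ increment_second_moment[OF j]])
    show "(\<lambda>\<omega>. norm (X (Suc n) j \<omega> - X n j \<omega>)) \<in> borel_measurable M" for n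
      using X_measurable[OF j] by measurable
  qed (auto intro!: mult_nonneg_nonneg sum_nonneg)
  have "AE \<omega> in M. summable (\<lambda>n. norm (X n i \<omega> - X n 1 \<omega>))"
  proof (rule AE_summable_if_geometric_second_moment[OF _ _ assms(1,2) _ pairwise_second_moment[OF i one]])
    show "(\<lambda>\<omega>. norm (X n i \<omega> - X n 1 \<omega>)) \<in> borel_measurable M" for n
      using X_measurable[OF i] X_measurable[OF one] by measurable
  qed auto
  with summable_steps[OF i] show ?thesis
  proof eventually_elim
    case (elim \<omega>)
    have "summable (\<lambda>n. X (Suc n) i \<omega> - X n i \<omega>)"
      using elim(1) by (rule summable_norm_cancel)
    then have "convergent (\<lambda>n. (X n i \<omega> - X 0 i \<omega>) + X 0 i \<omega>)"
      unfolding summable_iff_convergent sum_lessThan_telescope[of "\<lambda>n. X n i \<omega>"]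
      by (intro convergent_add convergent_const)
    then have conv: "convergent (\<lambda>n. X n i \<omega>)" by simp
    then have lim: "(\<lambda>n. X n i \<omega>) \<longlonglongrightarrow> lim (\<lambda>n. X n i \<omega>)"
      by (simp add: convergent_LIMSEQ_iff)
    have "(\<lambda>n. X n i \<omega> - X n 1 \<omega>) \<longlonglongrightarrow> 0"
      using summable_LIMSEQ_zero[OF elim(2)] by (rule tendsto_norm_zero_cancel)
    from tendsto_diff[OF lim this] have "lim (\<lambda>n. X n 1 \<omega>) = lim (\<lambda>n. X n i \<omega>)"
      by (intro limI) simp
    then show ?case using conv by (simp add: Cauchy_convergent_iff)
  qed
qed

end

section \<open>Random initial data\<close>

text \<open>Convergence is expressed through \<open>Cauchy\<close> and \<open>lim\<close>, for which measurability is
  immediate; Fubini needs the event to be measurable jointly in noise and initial data.\<close>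
lemma consensus_event_measurable:
  assumes "\<And>k. (\<lambda>\<omega>. z \<omega> k) \<in> borel_measurable Q"
    and "\<And>i. i \<in> {1..N} \<Longrightarrow> (\<lambda>\<omega>. x \<omega> i) \<in> borel_measurable Q"
    and i: "i \<in> {1..N}"
  shows "{\<omega>\<in>space Q. Cauchy (\<lambda>n. cbo_path (x \<omega>) (z \<omega>) n i) \<and>
    lim (\<lambda>n. cbo_path (x \<omega>) (z \<omega>) n i) = lim (\<lambda>n. cbo_path (x \<omega>) (z \<omega>) n 1)} \<in> sets Q"
proof -
  have [measurable]: "(\<lambda>\<omega>. cbo_path (x \<omega>) (z \<omega>) n j) \<in> borel_measurable Q" if "j \<in> {1..N}" for n j
    by (rule path_measurable[OF assms(1,2) that])
  have [measurable]: "(\<lambda>\<omega>. cbo_path (x \<omega>) (z \<omega>) n i) \<in> borel_measurable Q"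
    "(\<lambda>\<omega>. cbo_path (x \<omega>) (z \<omega>) n 1) \<in> borel_measurable Q" for n
    using i N by simp_all
  show ?thesis by measurable
qed

text \<open>\<open>AE_consensus\<close> fixes the initial data and lets the noise vary, so the almost-everywhere
  quantifiers come in the order initial data, noise; they are swapped because the independence
  hypothesis gives the joint law in the order noise, initial data.\<close>
lemma AE_consensus_random_initial_data:
  assumes M: "prob_space M" and noise: "cbo_noise M \<eta>"
    and sol: "pc_cbo_solution M S L N lam \<sigma> h \<beta> \<eta> w"
    and q: "0 < contraction" "contraction < 1" and i: "i \<in> {1..N}"
  shows "AE \<omega> in M. Cauchy (\<lambda>n. w n i \<omega>) \<and> lim (\<lambda>n. w n i \<omega>) = lim (\<lambda>n. w n 1 \<omega>)"
proof -
  interpret prob_space M by (rule M)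
  let ?Z = "Pi\<^sub>M UNIV (\<lambda>_. borel) :: (nat \<Rightarrow> real^'d) measure"
  let ?X = "Pi\<^sub>M {1..N} (\<lambda>_. borel) :: (nat \<Rightarrow> real^'d) measure"
  let ?z = "\<lambda>\<omega> n. \<eta> n \<omega>" and ?x = "\<lambda>\<omega>. \<lambda>l\<in>{1..N}. w 0 l \<omega>"
  define P where "P z x \<longleftrightarrow> Cauchy (\<lambda>n. cbo_path x z n i) \<and>
    lim (\<lambda>n. cbo_path x z n i) = lim (\<lambda>n. cbo_path x z n 1)" for z x
  have "indep_var ?Z ?z ?X ?x"
    using sol by (simp add: pc_cbo_solution_def cbo_noise_indep_initial_def)
  then have z[measurable]: "?z \<in> M \<rightarrow>\<^sub>M ?Z" and x[measurable]: "?x \<in> M \<rightarrow>\<^sub>M ?X"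
    and joint: "distr M ?Z ?z \<Otimes>\<^sub>M distr M ?X ?x = distr M (?Z \<Otimes>\<^sub>M ?X) (\<lambda>\<omega>. (?z \<omega>, ?x \<omega>))"
    by (simp_all add: indep_var_distribution_eq)
  interpret Z: prob_space "distr M ?Z ?z" by (rule prob_space_distr[OF z])
  interpret X: prob_space "distr M ?X ?x" by (rule prob_space_distr[OF x])
  interpret ZX: pair_sigma_finite "distr M ?Z ?z" "distr M ?X ?x" ..
  have "{y \<in> space (?Z \<Otimes>\<^sub>M ?X). P (fst y) (snd y)} \<in> sets (?Z \<Otimes>\<^sub>M ?X)"
    unfolding P_def
    by (rule consensus_event_measurable[OF _ _ i]) measurable
  then have meas: "{y \<in> space (distr M ?Z ?z \<Otimes>\<^sub>M distr M ?X ?x). P (fst y) (snd y)}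
      \<in> sets (distr M ?Z ?z \<Otimes>\<^sub>M distr M ?X ?x)"
    by (simp only: joint sets_distr space_distr)
  have "AE z in distr M ?Z ?z. P z x" for x
  proof (subst AE_distr_iff[OF z])
    show "{z \<in> space ?Z. P z x} \<in> sets ?Z"
      unfolding P_def by (rule consensus_event_measurable[OF _ _ i]) measurable
    show "AE \<omega> in M. P (?z \<omega>) x"
      unfolding P_def by (rule AE_consensus[OF M noise q i])
  qed
  then have "AE x in distr M ?X ?x. AE z in distr M ?Z ?z. P z x" by simp
  then have "AE z in distr M ?Z ?z. AE x in distr M ?X ?x. P z x"
    using meas by (subst ZX.AE_commute) (simp_all add: case_prod_beta')
  then have "AE y in distr M ?Z ?z \<Otimes>\<^sub>M distr M ?X ?x. P (fst y) (snd y)"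
    using meas by (intro ZX.AE_pair_measure) simp_all
  then have law: "AE y in distr M (?Z \<Otimes>\<^sub>M ?X) (\<lambda>\<omega>. (?z \<omega>, ?x \<omega>)). P (fst y) (snd y)"
    by (simp only: joint)
  have "(\<lambda>\<omega>. (?z \<omega>, ?x \<omega>)) \<in> M \<rightarrow>\<^sub>M ?Z \<Otimes>\<^sub>M ?X"
    by (intro measurable_Pair z x)
  from AE_distrD[OF this law] have "AE \<omega> in M. P (?z \<omega>) (?x \<omega>)"
    by (simp only: fst_conv snd_conv)
  then show ?thesis
  proof (rule AE_mp, intro AE_I2 impI)
    fix \<omega> assume "\<omega> \<in> space M" "P (?z \<omega>) (?x \<omega>)"
    then show "Cauchy (\<lambda>n. w n i \<omega>) \<and> lim (\<lambda>n. w n i \<omega>) = lim (\<lambda>n. w n 1 \<omega>)"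
      using i N by (simp add: P_def solution_eq_path[OF sol])
  qed
qed

end

section \<open>Convergence to consensus\<close>

theorem theorem3p5:
  fixes M :: "'a measure"
    and S :: "(real ^ 'd) set"
    and L :: "real ^ 'd \<Rightarrow> real"
    and N :: nat
    and lam \<sigma> h \<beta> :: real
    and \<eta> :: "nat \<Rightarrow> 'a \<Rightarrow> real ^ 'd"
    and w :: "nat \<Rightarrow> nat \<Rightarrow> 'a \<Rightarrow> real ^ 'd"
  assumes "prob_space M"
    and "N \<ge> 1"
    and "S \<noteq> {}" and "closed S" and "convex S"
    and "continuous_on S L"
    and "\<beta> > 0"
    and "cbo_noise M \<eta>"
    and "pc_cbo_solution M S L N lam \<sigma> h \<beta> \<eta> w"
    and "\<sigma> > 0" and "2 * lam > \<sigma>\<^sup>2"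
    and "0 < h" and "h < (2 * lam - \<sigma>\<^sup>2) / lam\<^sup>2"
  shows "\<exists>w_inf \<in> borel_measurable M.
           \<forall>i\<in>{1..N}. AE \<omega> in M. (\<lambda>n. w n i \<omega>) \<longlonglongrightarrow> w_inf \<omega>"
proof -
  interpret prob_space M by fact
  interpret projected_cbo S L N lam \<sigma> h \<beta>
    by unfold_locales (use assms in auto)
  have "0 < lam"
    using \<open>2 * lam > \<sigma>\<^sup>2\<close> zero_le_power2[of \<sigma>] by linarith
  have q: "(1 - lam * h)\<^sup>2 + (\<sigma> * sqrt h)\<^sup>2 = 1 - h * ((2 * lam - \<sigma>\<^sup>2) - lam\<^sup>2 * h)"
    using \<open>0 < h\<close> by (simp add: power2_eq_square algebra_simps)
  have "lam\<^sup>2 * h < 2 * lam - \<sigma>\<^sup>2"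
    using \<open>h < _\<close> \<open>0 < lam\<close> by (simp add: field_simps)
  (* The upper bound on h is exactly what makes the factor of h above positive. *)
  then have "contraction < 1"
    unfolding q using \<open>0 < h\<close> by simp
  moreover have "0 < contraction"
    using \<open>0 < \<sigma>\<close> \<open>0 < h\<close> by (intro add_nonneg_pos) auto
  ultimately have consensus:
    "AE \<omega> in M. Cauchy (\<lambda>n. w n i \<omega>) \<and> lim (\<lambda>n. w n i \<omega>) = lim (\<lambda>n. w n 1 \<omega>)"
    if "i \<in> {1..N}" for i
    using AE_consensus_random_initial_data[OF \<open>prob_space M\<close> \<open>cbo_noise M \<eta>\<close>
        \<open>pc_cbo_solution M S L N lam \<sigma> h \<beta> \<eta> w\<close>] that by blast
  have [measurable]: "w n i \<in> borel_measurable M" if i: "i \<in> {1..N}" for n i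
  proof -
    have "w 0 j \<in> borel_measurable M" if "j \<in> {1..N}" for j
      using assms(9) that by (simp add: pc_cbo_solution_def cbo_initial_data_def)
    then have "(\<lambda>\<omega>. cbo_path (\<lambda>l\<in>{1..N}. w 0 l \<omega>) (\<lambda>k. \<eta> k \<omega>) n i) \<in> borel_measurable M"
      by (intro path_measurable cbo_noise_measurable[OF assms(1) assms(8)] i) auto
    then show ?thesis
      by (subst measurable_cong[OF solution_eq_path[OF assms(9) _ i]])
  qed
  have [measurable]: "w n 1 \<in> borel_measurable M" for n
    using \<open>N \<ge> 1\<close> by simp
  show ?thesis
  proof (intro bexI ballI)
    show "(\<lambda>\<omega>. lim (\<lambda>n. w n 1 \<omega>)) \<in> borel_measurable M" by measurable
    fix i assume "i \<in> {1..N}"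
    from consensus[OF this] show "AE \<omega> in M. (\<lambda>n. w n i \<omega>) \<longlonglongrightarrow> lim (\<lambda>n. w n 1 \<omega>)"
      by eventually_elim (metis Cauchy_convergent_iff convergent_LIMSEQ_iff)
  qed
qed

end
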